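(* Let $n\ge 1$, let $\mathbf e=(e_1,e_2,\dots,e_n)$ with $e_i\in\{1,-1\}$, and let $\mathbf e(n)=(e_n,\dots,e_2,e_1,e_1,e_2,\dots,e_n)$. Then the Riley polynomial $\mathcal R(\lambda)\in\mathbb Z[\lambda]$ of the kmot group $G(\mathbf e(n))$ satisfies $$\mathcal R(-u^2)=(-1)^n s^{\mathbf e(n)}_{2n+1}(u)=v^{\mathbf e}_n(u)\,v^{\mathbf e}_n(-u)=f_n(-u^2).$$ In particular, the Riley polynomial $\mathcal R_K(\lambda)$ of a 2-bridge knot $K=S(\alpha,\beta)$ satisfies $$\mathcal R_K(-u^2)=(-1)^{\frac{\alpha-1}{2}}s^{\epsilon}_{\alpha}(u)=v^{\hat\epsilon}_{n}(u)\,v^{\hat\epsilon}_{n}(-u),\qquad n=\tfrac{\alpha-1}{2},$$ where $\epsilon=(\epsilon_1,\dots,\epsilon_{\alpha-1})$ with $\epsilon_i=(-1)^{\lfloor i\beta/\alpha\rfloor}$, and $\hat\epsilon=(\epsilon_{n},\epsilon_{n-1},\dots,\epsilon_2,\epsilon_1)$.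
   Context: Kmot groups and Riley polynomials: let $\alpha\ge 3$ be odd and let $\epsilon=(\epsilon_1,\dots,\epsilon_{\alpha-1})$, $\epsilon_i\in\{1,-1\}$, be symmetric, i.e. $\epsilon_i=\epsilon_{\alpha-i}$. The kmot group is $G(\epsilon)=\langle x,y\mid wx=yw\rangle$ with $w=x^{\epsilon_1}y^{\epsilon_2}x^{\epsilon_3}y^{\epsilon_4}\cdots x^{\epsilon_{\alpha-2}}y^{\epsilon_{\alpha-1}}$. Its Riley polynomial $\mathcal R(\lambda)\in\mathbb Z[\lambda]$ is the $(1,1)$-entry $W_{11}$ of $$W(\epsilon)=\begin{pmatrix}1&1\\0&1\end{pmatrix}^{\epsilon_1}\begin{pmatrix}1&0\\\lambda&1\end{pmatrix}^{\epsilon_2}\cdots\begin{pmatrix}1&1\\0&1\end{pmatrix}^{\epsilon_{\alpha-2}}\begin{pmatrix}1&0\\\lambda&1\end{pmatrix}^{\epsilon_{\alpha-1}}.$$ For a 2-bridge knot $K=S(\alpha,\beta)$ (Schubert form; $\alpha\ge3$ odd, $\beta$ odd and coprime to $\alpha$), the knot group is the kmot group $G(\epsilon)$ with $\epsilon_i=(-1)^{\lfloor i\beta/\alpha\rfloor}$ (this sequence is symmetric), and $\mathcal R_K$ is its Riley polynomial. $\epsilon$-Chebyshev polynomials: for a sequence $\epsilon=(\epsilon_1,\epsilon_2,\dots)$ of signs $\pm1$ (finite of length $m$ or infinite), $\mathcal E Ch^t_n(a,b)$ denotes the sequence $g_n(t)$ with $g_0=a$, $g_1=b$, $g_{n+1}(t)=\epsilon_n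 t\,g_n(t)-g_{n-1}(t)$ for $n\ge1$ (defined for $n\le m+1$ if $\epsilon$ has length $m$). Set $s^\epsilon_n(t)=\mathcal E Ch^t_n(0,1)$ and $v^\epsilon_n(t)=\mathcal E Ch^t_{n+1}(1,1)$. The polynomials $f_n\in\mathbb Z[\lambda]$ (depending on $e_1,e_2,\dots$) are defined by $f_0=1$, $f_1=1+\lambda$, and for $n\ge2$, $f_n=f_{n-2}+\lambda f_{n-1}+2e_n\lambda\,(e_{n-1}f_{n-2}+e_{n-2}f_{n-3}+\cdots+e_2f_1+e_1f_0)$. *)

theory Defs
  imports "HOL-Analysis.Analysis" "HOL-Computational_Algebra.Polynomial"
begin

text \<open>
  A sign sequence is a function \<open>\<epsilon> :: nat \<Rightarrow> int\<close> read at the indices \<open>1, 2, \<dots>\<close>; for a finite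
  sequence of length \<open>m\<close> only the values at \<open>1, \<dots>, m\<close> are used and constrained.
\<close>

text \<open>
  The sequences \<open>(\<epsilon>\<^sub>1, \<dots>, \<epsilon>\<^bsub>\<alpha>-1\<^esub>)\<close> that present a kmot group
  \<open>G(\<epsilon>) = \<langle>x, y | w x = y w\<rangle>\<close> with \<open>w = x\<^bsup>\<epsilon>\<^sub>1\<^esup> y\<^bsup>\<epsilon>\<^sub>2\<^esup> \<cdots> y\<^bsup>\<epsilon>\<^bsub>\<alpha>-1\<^esub>\<^esup>\<close>.
\<close>

definition kmot_signs :: "nat \<Rightarrow> (nat \<Rightarrow> int) \<Rightarrow> bool" where
  "kmot_signs \<alpha> \<epsilon> \<longleftrightarrow> odd \<alpha> \<and> 3 \<le> \<alpha> \<and>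
     (\<forall>i\<in>{1..<\<alpha>}. \<epsilon> i \<in> {1, -1} \<and> \<epsilon> i = \<epsilon> (\<alpha> - i))"

definition X_mat :: "int poly^2^2" where
  "X_mat = vector [vector [1, 1], vector [0, 1]]"

definition Y_mat :: "int poly^2^2" where
  "Y_mat = vector [vector [1, 0], vector [[:0, 1:], 1]]"

text \<open>\<open>A\<^bsup>e\<^esup>\<close>, for exponents \<open>e \<in> {1, -1}\<close> only.\<close>

definition sign_pow :: "int poly^2^2 \<Rightarrow> int \<Rightarrow> int poly^2^2" where
  "sign_pow A e = (if e = 1 then A else matrix_inv A)"

text \<open>The product of the first \<open>2 m\<close> factors of \<open>W(\<epsilon>)\<close>; so \<open>W(\<epsilon>)\<close> itself is the case
  \<open>m = (\<alpha> - 1) / 2\<close>. The variable \<open>[:0, 1:]\<close> is \<open>\<lambda>\<close>.\<close>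

fun W_mat :: "(nat \<Rightarrow> int) \<Rightarrow> nat \<Rightarrow> int poly^2^2" where
  "W_mat \<epsilon> 0 = mat 1"
| "W_mat \<epsilon> (Suc m) =
     W_mat \<epsilon> m ** sign_pow X_mat (\<epsilon> (2 * m + 1)) ** sign_pow Y_mat (\<epsilon> (2 * m + 2))"

definition riley_poly :: "nat \<Rightarrow> (nat \<Rightarrow> int) \<Rightarrow> int poly" where
  "riley_poly \<alpha> \<epsilon> = W_mat \<epsilon> ((\<alpha> - 1) div 2) $ 1 $ 1"

text \<open>\<open>(-1)\<^bsup>\<lfloor>i \<beta> / \<alpha>\<rfloor>\<^esup>\<close>; the floor may be negative, as \<open>\<beta>\<close> may be.\<close>

definition two_bridge_signs :: "nat \<Rightarrow> int \<Rightarrow> nat \<Rightarrow> int" where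
  "two_bridge_signs \<alpha> \<beta> i = (if even ((int i * \<beta>) div int \<alpha>) then 1 else -1)"

text \<open>The Riley polynomial of the 2-bridge knot with Schubert form \<open>S(\<alpha>, \<beta>)\<close>.\<close>

definition riley_poly_two_bridge :: "nat \<Rightarrow> int \<Rightarrow> int poly" where
  "riley_poly_two_bridge \<alpha> \<beta> = riley_poly \<alpha> (two_bridge_signs \<alpha> \<beta>)"

text \<open>\<open>(e\<^sub>n, \<dots>, e\<^sub>1)\<close>, and \<open>\<^bold>e(n) = (e\<^sub>n, \<dots>, e\<^sub>1, e\<^sub>1, \<dots>, e\<^sub>n)\<close>.\<close>

definition rev_signs :: "nat \<Rightarrow> (nat \<Rightarrow> int) \<Rightarrow> nat \<Rightarrow> int" where
  "rev_signs n e i = e (n + 1 - i)"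

definition palindrome_signs :: "nat \<Rightarrow> (nat \<Rightarrow> int) \<Rightarrow> nat \<Rightarrow> int" where
  "palindrome_signs n e i = (if i \<le> n then e (n + 1 - i) else e (i - n))"

fun eps_cheb :: "(nat \<Rightarrow> int) \<Rightarrow> 'a::comm_ring_1 \<Rightarrow> 'a \<Rightarrow> 'a \<Rightarrow> nat \<Rightarrow> 'a" where
  "eps_cheb \<epsilon> t a b 0 = a"
| "eps_cheb \<epsilon> t a b (Suc 0) = b"
| "eps_cheb \<epsilon> t a b (Suc (Suc n)) =
     of_int (\<epsilon> (Suc n)) * t * eps_cheb \<epsilon> t a b (Suc n) - eps_cheb \<epsilon> t a b n"

definition s_poly :: "(nat \<Rightarrow> int) \<Rightarrow> nat \<Rightarrow> int poly" where
  "s_poly \<epsilon> n = eps_cheb \<epsilon> [:0, 1:] 0 1 n"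

definition v_poly :: "(nat \<Rightarrow> int) \<Rightarrow> nat \<Rightarrow> int poly" where
  "v_poly \<epsilon> n = eps_cheb \<epsilon> [:0, 1:] 1 1 (n + 1)"

fun f_poly :: "(nat \<Rightarrow> int) \<Rightarrow> nat \<Rightarrow> int poly" where
  "f_poly e 0 = 1"
| "f_poly e (Suc 0) = [:1, 1:]"
| "f_poly e (Suc (Suc n)) =
     f_poly e n + [:0, 1:] * f_poly e (Suc n)
     + of_int (2 * e (Suc (Suc n))) * [:0, 1:]
       * (\<Sum>k\<in>{1..Suc n}. of_int (e k) * f_poly e (k - 1))"

lemma kmot_signs_palindrome_signs:
  assumes "1 \<le> n" and "\<forall>i\<in>{1..n}. e i \<in> {1, -1}"
  shows "kmot_signs (2 * n + 1) (palindrome_signs n e)"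
  unfolding kmot_signs_def
proof (intro conjI ballI)
  fix i assume i: "i \<in> {1..<2 * n + 1}"
  show "palindrome_signs n e i \<in> {1, -1}"
  proof (cases "i \<le> n")
    case True
    then have "n + 1 - i \<in> {1..n}" using i by auto
    then show ?thesis using True assms(2) unfolding palindrome_signs_def by simp
  next
    case False
    then have "i - n \<in> {1..n}" using i by auto
    then show ?thesis using False assms(2) unfolding palindrome_signs_def by simp
  qed
  show "palindrome_signs n e i = palindrome_signs n e (2 * n + 1 - i)"
  proof (cases "i \<le> n")
    case True
    then have "\<not> 2 * n + 1 - i \<le> n" "2 * n + 1 - i - n = n + 1 - i" using i by auto
    then show ?thesis using True unfolding palindrome_signs_def by simp
  next
    case False
    then have "2 * n + 1 - i \<le> n" "n + 1 - (2 * n + 1 - i) = i - n" using i by auto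
    then show ?thesis using False unfolding palindrome_signs_def by simp
  qed
qed (use assms(1) in auto)

lemma kmot_signs_two_bridge_signs:
  assumes "odd \<alpha>" and "3 \<le> \<alpha>" and "odd \<beta>" and cop: "coprime (int \<alpha>) \<beta>"
  shows "kmot_signs \<alpha> (two_bridge_signs \<alpha> \<beta>)"
  unfolding kmot_signs_def
proof (intro conjI ballI)
  fix i assume i: "i \<in> {1..<\<alpha>}"
  show "two_bridge_signs \<alpha> \<beta> i \<in> {1, -1}"
    by (simp add: two_bridge_signs_def)
  let ?a = "int \<alpha>" and ?q = "(int i * \<beta>) div int \<alpha>"
  have ndvd: "\<not> ?a dvd int i * \<beta>"
  proof
    assume "?a dvd int i * \<beta>"
    then have "?a dvd int i" using cop coprime_dvd_mult_left_iff by blast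
    then show False using i by (auto dest: zdvd_imp_le)
  qed
  have "int (\<alpha> - i) * \<beta> = - (int i * \<beta>) + \<beta> * ?a"
    using i by (simp add: of_nat_diff algebra_simps)
  then have "(int (\<alpha> - i) * \<beta>) div ?a = - (int i * \<beta>) div ?a + \<beta>"
    using assms(2) by (simp only: div_mult_self1)
  also have "- (int i * \<beta>) div ?a = - ?q - 1"
    using ndvd assms(2) zdiv_zminus1_eq_if[of ?a "int i * \<beta>"] by (auto simp: dvd_eq_mod_eq_0)
  finally have "even ((int (\<alpha> - i) * \<beta>) div ?a) \<longleftrightarrow> even ?q"
    using assms(3) by simp
  then show "two_bridge_signs \<alpha> \<beta> i = two_bridge_signs \<alpha> \<beta> (\<alpha> - i)"
    by (simp add: two_bridge_signs_def)
qed (use assms in auto)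

end

theory Submission
  imports Defs
begin

text \<open>
  Along the first row of the partial products of \<open>W(\<epsilon>)\<close> at \<open>\<lambda> = -u\<^sup>2\<close> the two entries are, up to
  signs and a factor \<open>u\<close>, consecutive values of \<open>s\<^sup>\<epsilon>\<close>; this gives the Riley polynomial.
  For a solution \<open>g\<close> of the recurrence for \<open>e\<close> and the solution \<open>r\<close> with \<open>r\<^sub>0 = 0\<close>, \<open>r\<^sub>1 = 1\<close> for the
  reversed signs, the Casoratian-like quantity \<open>g\<^bsub>n+1-k\<^esub> r\<^bsub>k+1\<^esub> - g\<^bsub>n-k\<^esub> r\<^sub>k\<close> does not depend on \<open>k\<close>, hence
  \<open>g\<^bsub>n+1\<^esub> = g\<^sub>1 r\<^bsub>n+1\<^esub> - g\<^sub>0 r\<^sub>n\<close>. Applied to the second half of the palindrome this yields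
  \<open>s\<^bsub>2n+1\<^esub> = r\<^bsub>n+1\<^esub>\<^sup>2 - r\<^sub>n\<^sup>2\<close>, whose two factors are \<open>v\<^sub>n(u)\<close> and \<open>(-1)\<^sup>n v\<^sub>n(-u)\<close>. Finally, the products
  \<open>v\<^sub>n(u) v\<^sub>n(-u)\<close> satisfy the recurrence of \<open>f\<^sub>n(-u\<^sup>2)\<close>, the sum in it coming from the Casoratian of
  \<open>v\<^sub>n(u)\<close> and \<open>v\<^sub>n(-u)\<close>.
\<close>

section \<open>Sign-dependent recurrences and palindromic signs\<close>

lemma eps_cheb_cong:
  assumes "\<And>i. 1 \<le> i \<Longrightarrow> i < n \<Longrightarrow> \<epsilon> i = \<delta> i"
  shows "eps_cheb \<epsilon> t a b n = eps_cheb \<delta> t a b n"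
  using assms
proof (induction n rule: less_induct)
  case (less n)
  then show ?case
    by (cases "(\<epsilon>, t, a, b, n)" rule: eps_cheb.cases) auto
qed

lemma eps_cheb_add:
  "eps_cheb \<epsilon> t a b (m + k) =
     eps_cheb (\<lambda>i. \<epsilon> (m + i)) t (eps_cheb \<epsilon> t a b m) (eps_cheb \<epsilon> t a b (Suc m)) k"
  by (induction k rule: induct_nat_012) simp_all

text \<open>If g solves the recurrence for \<open>t\<close>, then (-1)^n g_n solves it for
  \<open>- t\<close>. The exponent \<open>Suc n\<close> puts the change of sign on the value at 0
  and leaves the value at 1 alone.\<close>

lemma eps_cheb_uminus:
  "eps_cheb \<epsilon> (- t) a b n = (-1) ^ Suc n * eps_cheb \<epsilon> t (- a) b n"
  by (induction n rule: induct_nat_012) (simp_all add: algebra_simps)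

lemma pcompose_of_int: "pcompose (of_int k) q = of_int k"
  by (simp add: of_int_poly pcompose_const)

lemma pcompose_eps_cheb:
  "pcompose (eps_cheb \<epsilon> t a b n) q = eps_cheb \<epsilon> (pcompose t q) (pcompose a q) (pcompose b q) n"
  by (induction n rule: induct_nat_012)
    (simp_all add: pcompose_diff pcompose_mult pcompose_of_int)

lemma eps_cheb_rev_signs_invariant:
  fixes t a b :: "'a::comm_ring_1" and e :: "nat \<Rightarrow> int"
  defines "g \<equiv> eps_cheb e t a b"
  assumes "k \<le> n"
  shows "g (Suc (n - k)) * eps_cheb (rev_signs n e) t 0 1 (Suc k)
           - g (n - k) * eps_cheb (rev_signs n e) t 0 1 k = g (Suc n)"
  using assms(2)
proof (induction k)
  case (Suc k)
  then obtain j where j: "n - k = Suc j" "n - Suc k = j" "Suc n - Suc k = Suc j"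
    by (metis Suc_diff_Suc diff_Suc_Suc Suc_le_lessD)
  \<comment> \<open>The reversed sign at \<open>Suc k\<close> is \<open>e (n - k)\<close>, the very
    sign by which \<open>g\<close> passes from \<open>n - k\<close> to \<open>Suc (n - k)\<close>;
    expanding both recurrences leaves the same terms.\<close>
  then show ?case
    using Suc by (simp add: g_def rev_signs_def algebra_simps)
qed simp

lemma eps_cheb_eq_rev_signs:
  "eps_cheb e t a b (Suc n) =
     b * eps_cheb (rev_signs n e) t 0 1 (Suc n) - a * eps_cheb (rev_signs n e) t 0 1 n"
  using eps_cheb_rev_signs_invariant[of n n e t a b] by simp

lemma eps_cheb_palindrome_signs:
  fixes t :: "'a::comm_ring_1" and e :: "nat \<Rightarrow> int"
  shows "eps_cheb (palindrome_signs n e) t 0 1 (2 * n + 1) =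
     (-1) ^ n * (eps_cheb e t 1 1 (Suc n) * eps_cheb e (- t) 1 1 (Suc n))"
proof -
  define r where "r = eps_cheb (rev_signs n e) t 0 1"
  \<comment> \<open>\<open>Suc n\<close> is allowed because the value there reads only the signs 1
    to \<open>n\<close>.\<close>
  have first_half: "eps_cheb (palindrome_signs n e) t 0 1 k = r k" if "k \<le> Suc n" for k
    unfolding r_def
    by (rule eps_cheb_cong) (use that in \<open>simp add: palindrome_signs_def rev_signs_def\<close>)
  have "eps_cheb (palindrome_signs n e) t 0 1 (n + Suc n) =
      eps_cheb (\<lambda>i. palindrome_signs n e (n + i)) t (r n) (r (Suc n)) (Suc n)"
    by (simp only: eps_cheb_add[of _ _ _ _ n "Suc n"] first_half le_SucI order_refl)
  \<comment> \<open>Past the middle the signs are e_1, e_2, ... again; the two sequences may differ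
    at index 0, which is never read.\<close>
  also have "\<dots> = eps_cheb e t (r n) (r (Suc n)) (Suc n)"
    by (rule eps_cheb_cong) (simp add: palindrome_signs_def)
  also have "\<dots> = r (Suc n) * r (Suc n) - r n * r n"
    by (simp only: eps_cheb_eq_rev_signs[of e t] r_def)
  also have "\<dots> = (r (Suc n) - r n) * (r (Suc n) + r n)"
    by (simp add: algebra_simps)
  also have "r (Suc n) - r n = eps_cheb e t 1 1 (Suc n)"
    by (simp only: eps_cheb_eq_rev_signs[of e t] r_def mult_1)
  \<comment> \<open>Negating the parameter turns the starting values (1, 1) into (-1, 1), hence the
    difference into a sum.\<close>
  also have "r (Suc n) + r n = (-1) ^ n * eps_cheb e (- t) 1 1 (Suc n)"
    unfolding eps_cheb_uminus eps_cheb_eq_rev_signs[of e t "- 1"] r_def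
    by (simp add: algebra_simps)
  finally show ?thesis
    by (simp only: mult_2 add.assoc Suc_eq_plus1 mult.left_commute)
qed

lemma s_poly_palindrome_signs:
  "(-1) ^ n * s_poly (palindrome_signs n e) (2 * n + 1) =
     v_poly e n * pcompose (v_poly e n) [:0, -1:]"
proof -
  have "pcompose (v_poly e n) [:0, -1:] = eps_cheb e (- [:0, 1:]) 1 1 (Suc n)"
    by (simp add: v_poly_def pcompose_eps_cheb pcompose_pCons pcompose_1 del: eps_cheb.simps)
  then show ?thesis
    unfolding s_poly_def eps_cheb_palindrome_signs v_poly_def
    by (simp del: eps_cheb.simps)
qed

section \<open>First row of W and the Riley polynomial\<close>

lemma matrix_inv_unique:
  fixes A :: "'a::semiring_1^'n^'n"
  assumes "A ** B = mat 1" "B ** A = mat 1"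
  shows "matrix_inv A = B"
proof -
  \<comment> \<open>\<open>matrix_inv\<close> is a choice among two-sided inverses, and
    \<open>B\<close> witnesses that there is one.\<close>
  have "A ** matrix_inv A = mat 1"
    unfolding matrix_inv_def by (rule someI2[of _ B]) (use assms in auto)
  then have "B ** (A ** matrix_inv A) = B"
    by simp
  then show ?thesis
    by (simp add: matrix_mul_assoc assms)
qed

lemma sign_pow_X_mat:
  assumes "e \<in> {1, -1}"
  shows "sign_pow X_mat e = vector [vector [1, of_int e], vector [0, 1]]"
proof -
  have "matrix_inv X_mat = vector [vector [1, -1], vector [0, 1]]"
    by (rule matrix_inv_unique)
      (simp_all add: X_mat_def vec_eq_iff forall_2 matrix_matrix_mult_def sum_2 mat_def)
  then show ?thesis
    using assms by (auto simp: sign_pow_def X_mat_def)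
qed

lemma sign_pow_Y_mat:
  assumes "e \<in> {1, -1}"
  shows "sign_pow Y_mat e = vector [vector [1, 0], vector [of_int e * [:0, 1:], 1]]"
proof -
  have "matrix_inv Y_mat = vector [vector [1, 0], vector [- [:0, 1:], 1]]"
    by (rule matrix_inv_unique)
      (simp_all add: Y_mat_def one_pCons vec_eq_iff forall_2 matrix_matrix_mult_def sum_2 mat_def)
  then show ?thesis
    using assms by (elim insertE) (simp_all add: sign_pow_def Y_mat_def)
qed

text \<open>Each matrix factor advances the recurrence by one step. The factor
  \<open>[:0, 1:]\<close> on the second entry avoids dividing \<open>s_poly\<close> at an even index
  by u.\<close>

lemma W_mat_first_row:
  assumes "\<forall>i\<in>{1..2 * m}. \<epsilon> i \<in> {1, -1}"
  shows "pcompose (W_mat \<epsilon> m $ 1 $ 1) [:0, 0, -1:] = (-1) ^ m * s_poly \<epsilon> (2 * m + 1)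
     \<and> [:0, 1:] * pcompose (W_mat \<epsilon> m $ 1 $ 2) [:0, 0, -1:] = - ((-1) ^ m * s_poly \<epsilon> (2 * m))"
  using assms
proof (induction m)
  case 0
  show ?case
    by (simp add: mat_def s_poly_def pcompose_1)
next
  case (Suc m)
  let ?u = "[:0, 1:] :: int poly" and ?q = "[:0, 0, -1:] :: int poly"
  let ?s = "s_poly \<epsilon>"
  have signs: "\<forall>i\<in>{1..2 * m}. \<epsilon> i \<in> {1, -1}"
      "\<epsilon> (2 * m + 1) \<in> {1, -1}" "\<epsilon> (2 * m + 2) \<in> {1, -1}"
    using Suc.prems by auto
  note IH = Suc.IH[OF signs(1), THEN conjunct1] Suc.IH[OF signs(1), THEN conjunct2]
  \<comment> \<open>The \<open>X_mat\<close> factor changes only the second entry of the row, the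
    \<open>Y_mat\<close> factor only the first. Here \<open>?u\<close> is still \<lambda>; after
    composition with \<open>?q\<close> it denotes u, and \<open>u2\<close> converts.\<close>
  have row: "W_mat \<epsilon> (Suc m) $ 1 $ 2 = of_int (\<epsilon> (2 * m + 1)) * W_mat \<epsilon> m $ 1 $ 1 + W_mat \<epsilon> m $ 1 $ 2"
    "W_mat \<epsilon> (Suc m) $ 1 $ 1
       = W_mat \<epsilon> m $ 1 $ 1 + of_int (\<epsilon> (2 * m + 2)) * ?u * W_mat \<epsilon> (Suc m) $ 1 $ 2"
    by (simp_all only: W_mat.simps sign_pow_X_mat[OF signs(2)] sign_pow_Y_mat[OF signs(3)])
      (simp_all add: matrix_matrix_mult_def sum_2 algebra_simps)
  have s2: "?s (2 * m + 2) = of_int (\<epsilon> (2 * m + 1)) * ?u * ?s (2 * m + 1) - ?s (2 * m)"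
    and s3: "?s (2 * m + 3) = of_int (\<epsilon> (2 * m + 2)) * ?u * ?s (2 * m + 2) - ?s (2 * m + 1)"
    by (simp_all add: s_poly_def numeral_eq_Suc)
  have "?u * pcompose (W_mat \<epsilon> (Suc m) $ 1 $ 2) ?q =
      of_int (\<epsilon> (2 * m + 1)) * ?u * pcompose (W_mat \<epsilon> m $ 1 $ 1) ?q
      + ?u * pcompose (W_mat \<epsilon> m $ 1 $ 2) ?q"
    by (simp only: row pcompose_add pcompose_mult pcompose_of_int) (simp only: algebra_simps)
  also have "\<dots> = (-1) ^ m * ?s (2 * m + 2)"
    by (simp only: IH s2) (simp only: algebra_simps)
  finally have q: "?u * pcompose (W_mat \<epsilon> (Suc m) $ 1 $ 2) ?q = (-1) ^ m * ?s (2 * m + 2)" .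
  have u2: "pcompose ?u ?q = - (?u * ?u)"
    by (simp add: pcompose_pCons)
  have "pcompose (W_mat \<epsilon> (Suc m) $ 1 $ 1) ?q = pcompose (W_mat \<epsilon> m $ 1 $ 1) ?q
      - of_int (\<epsilon> (2 * m + 2)) * ?u * (?u * pcompose (W_mat \<epsilon> (Suc m) $ 1 $ 2) ?q)"
    by (simp only: row(2) pcompose_add pcompose_mult pcompose_of_int u2)
      (simp only: algebra_simps minus_mult_left[symmetric] minus_mult_right[symmetric])
  also have "\<dots> = - ((-1) ^ m * ?s (2 * m + 3))"
    by (simp only: IH q s3) (simp only: algebra_simps)
  finally have p: "pcompose (W_mat \<epsilon> (Suc m) $ 1 $ 1) ?q = - ((-1) ^ m * ?s (2 * m + 3))" .
  show ?case
    using p q by (simp add: numeral_eq_Suc del: W_mat.simps)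
qed

lemma kmot_signsD:
  assumes "kmot_signs \<alpha> \<epsilon>" "1 \<le> i" "i < \<alpha>"
  shows "\<epsilon> i \<in> {1, -1}" and "\<epsilon> (\<alpha> - i) = \<epsilon> i"
proof -
  have "i \<in> {1..<\<alpha>}"
    using assms by simp
  with assms(1) have "\<epsilon> i \<in> {1, -1} \<and> \<epsilon> i = \<epsilon> (\<alpha> - i)"
    unfolding kmot_signs_def by blast
  then show "\<epsilon> i \<in> {1, -1}" and "\<epsilon> (\<alpha> - i) = \<epsilon> i"
    by (blast, metis)
qed

lemma pcompose_riley_poly:
  assumes "kmot_signs \<alpha> \<epsilon>"
  shows "pcompose (riley_poly \<alpha> \<epsilon>) [:0, 0, -1:] = (-1) ^ ((\<alpha> - 1) div 2) * s_poly \<epsilon> \<alpha>"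
proof -
  obtain m where \<alpha>: "\<alpha> = 2 * m + 1"
    using assms unfolding kmot_signs_def by (elim conjE oddE)
  then have "\<forall>i\<in>{1..2 * m}. \<epsilon> i \<in> {1, -1}"
    using kmot_signsD(1)[OF assms] by (simp del: insert_iff)
  then show ?thesis
    unfolding \<alpha> riley_poly_def using W_mat_first_row[of m \<epsilon>] by simp
qed

section \<open>The recurrence of f_n\<close>

text \<open>For equal parameters the Casoratian would be constant. For opposite ones each step adds
  2 t e_k P_k Q_k, starting from 0 because both sequences begin with (1, 1).\<close>

lemma eps_cheb_casoratian:
  fixes t :: "'a::comm_ring_1" and e :: "nat \<Rightarrow> int"
  defines "P \<equiv> eps_cheb e t 1 1" and "Q \<equiv> eps_cheb e (- t) 1 1"
  shows "P (Suc n) * Q n - P n * Q (Suc n) = 2 * t * (\<Sum>k\<in>{1..n}. of_int (e k) * (P k * Q k))"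
  by (induction n) (simp_all add: P_def Q_def algebra_simps)

lemma v_poly_mult_pcompose_eq_f_poly:
  assumes "\<forall>i\<in>{1..n}. e i \<in> {1, -1}"
  shows "v_poly e n * pcompose (v_poly e n) [:0, -1:] = pcompose (f_poly e n) [:0, 0, -1:]"
proof -
  let ?u = "[:0, 1:] :: int poly" and ?q = "[:0, 0, -1:] :: int poly"
  define P where "P = eps_cheb e ?u 1 1"
  define Q where "Q = eps_cheb e (- ?u) 1 1"
  have u2: "pcompose ?u ?q = - (?u * ?u)"
    by (simp add: pcompose_pCons)
  have "P (Suc n) * Q (Suc n) = pcompose (f_poly e n) ?q"
    using assms
  proof (induction n rule: less_induct)
    case (less n)
    show ?case
    proof (cases "(e, n)" rule: f_poly.cases)
      case 1
      then show ?thesis by (simp add: P_def Q_def pcompose_1)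
    next
      case 2
      then have "e 1 = 1 \<or> e 1 = -1" using less.prems by auto
      then show ?thesis using 2
        by (auto simp: P_def Q_def pcompose_pCons one_pCons)
    next
      case (3 e' m)
      then have n: "n = Suc (Suc m)" by simp
      let ?c = "of_int (e n) :: int poly"
      let ?S = "\<Sum>k\<in>{1..Suc m}. of_int (e k) * (P k * Q k)"
      have sq: "?c * ?c = 1"
        using bspec[OF less.prems, of n] n by (auto simp flip: of_int_mult)
      have IH: "P (Suc k) * Q (Suc k) = pcompose (f_poly e k) ?q" if "k < n" for k
        using less that by simp
      \<comment> \<open>Index shift: P_k Q_k corresponds to f_{k-1}, since v_k is the value at k +
        1.\<close>
      have S: "?S = pcompose (\<Sum>k\<in>{1..Suc m}. of_int (e k) * f_poly e (k - 1)) ?q"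
        unfolding pcompose_sum
      proof (rule sum.cong)
        fix k assume "k \<in> {1..Suc m}"
        then have "k - 1 < n" "Suc (k - 1) = k"
          using n by auto
        then show "of_int (e k) * (P k * Q k) = pcompose (of_int (e k) * f_poly e (k - 1)) ?q"
          using IH[of "k - 1"] by (simp only: pcompose_mult pcompose_of_int)
      qed simp
      have C: "P n * Q (Suc m) - P (Suc m) * Q n = 2 * ?u * ?S"
        unfolding n P_def Q_def by (rule eps_cheb_casoratian)
      have rec: "P (Suc n) = ?c * ?u * P n - P (Suc m)" "Q (Suc n) = - (?c * ?u * Q n) - Q (Suc m)"
        by (simp_all add: P_def Q_def n)
      \<comment> \<open>The cross terms of the product form the Casoratian \<open>C\<close>; the
        square of the sign disappears by \<open>sq\<close>.\<close>
      have "P (Suc n) * Q (Suc n) = P (Suc m) * Q (Suc m) - (?c * ?c) * (?u * ?u) * (P n * Q n)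
          - ?c * ?u * (P n * Q (Suc m) - P (Suc m) * Q n)"
        unfolding rec by (simp only: algebra_simps minus_mult_left[symmetric] minus_mult_right[symmetric])
      also have "\<dots> = P (Suc m) * Q (Suc m) - (?u * ?u) * (P n * Q n) - 2 * ?c * (?u * ?u) * ?S"
        unfolding C sq by (simp only: algebra_simps)
      also have "\<dots> = pcompose (f_poly e m) ?q - (?u * ?u) * pcompose (f_poly e (Suc m)) ?q
          - 2 * ?c * (?u * ?u) * ?S"
        using IH[of m] IH[of "Suc m"] by (simp only: n lessI less_SucI)
      also have "\<dots> = pcompose (f_poly e n) ?q"
        unfolding S n f_poly.simps pcompose_add pcompose_mult pcompose_of_int u2
        by (simp only: of_int_mult of_int_numeral algebra_simps
            minus_mult_left[symmetric] minus_mult_right[symmetric])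
      finally show ?thesis .
    qed
  qed
  moreover have "pcompose (v_poly e n) [:0, -1:] = Q (Suc n)"
    by (simp add: v_poly_def Q_def pcompose_eps_cheb pcompose_pCons pcompose_1 del: eps_cheb.simps)
  ultimately show ?thesis
    by (simp add: v_poly_def P_def del: eps_cheb.simps)
qed

section \<open>Symmetric sign sequences and 2-bridge knots\<close>

text \<open>Double reversal settles the first half, symmetry of \<epsilon> the second. Thus the
  2-bridge case reduces to palindromes.\<close>

lemma palindrome_signs_rev_signs:
  assumes "kmot_signs (2 * n + 1) \<epsilon>" "1 \<le> i" "i < 2 * n + 1"
  shows "palindrome_signs n (rev_signs n \<epsilon>) i = \<epsilon> i"
proof (cases "i \<le> n")
  case False
  then have "n + 1 - (i - n) = 2 * n + 1 - i"
    by simp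
  moreover have "\<epsilon> (2 * n + 1 - i) = \<epsilon> i"
    using assms by (rule kmot_signsD)
  ultimately show ?thesis
    using False by (simp add: palindrome_signs_def rev_signs_def)
qed (use assms(2) in \<open>simp add: palindrome_signs_def rev_signs_def\<close>)

lemma s_poly_kmot_signs:
  assumes "kmot_signs (2 * n + 1) \<epsilon>"
  shows "(-1) ^ n * s_poly \<epsilon> (2 * n + 1) =
     v_poly (rev_signs n \<epsilon>) n * pcompose (v_poly (rev_signs n \<epsilon>) n) [:0, -1:]"
proof -
  have "s_poly \<epsilon> (2 * n + 1) = s_poly (palindrome_signs n (rev_signs n \<epsilon>)) (2 * n + 1)"
    unfolding s_poly_def
    by (rule eps_cheb_cong) (simp add: palindrome_signs_rev_signs[OF assms])
  then show ?thesis
    by (simp only: s_poly_palindrome_signs)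
qed

theorem corollary5p3:
  shows "(\<forall>(n::nat) (e::nat \<Rightarrow> int).
            1 \<le> n \<and> (\<forall>i\<in>{1..n}. e i \<in> {1, -1}) \<longrightarrow>
              pcompose (riley_poly (2 * n + 1) (palindrome_signs n e)) [:0, 0, -1:]
                = (-1) ^ n * s_poly (palindrome_signs n e) (2 * n + 1)
            \<and> (-1) ^ n * s_poly (palindrome_signs n e) (2 * n + 1)
                = v_poly e n * pcompose (v_poly e n) [:0, -1:]
            \<and> v_poly e n * pcompose (v_poly e n) [:0, -1:]
                = pcompose (f_poly e n) [:0, 0, -1:])
       \<and> (\<forall>(\<alpha>::nat) (\<beta>::int) (n::nat) (\<epsilon>::nat \<Rightarrow> int).
            3 \<le> \<alpha> \<and> odd \<alpha> \<and> odd \<beta> \<and> coprime (int \<alpha>) \<beta>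
            \<and> n = (\<alpha> - 1) div 2 \<and> \<epsilon> = two_bridge_signs \<alpha> \<beta> \<longrightarrow>
              pcompose (riley_poly_two_bridge \<alpha> \<beta>) [:0, 0, -1:]
                = (-1) ^ ((\<alpha> - 1) div 2) * s_poly \<epsilon> \<alpha>
            \<and> (-1) ^ ((\<alpha> - 1) div 2) * s_poly \<epsilon> \<alpha>
                = v_poly (rev_signs n \<epsilon>) n * pcompose (v_poly (rev_signs n \<epsilon>) n) [:0, -1:])"
proof (intro conjI allI impI; elim conjE)
  fix n :: nat and e :: "nat \<Rightarrow> int"
  assume n: "1 \<le> n" and e: "\<forall>i\<in>{1..n}. e i \<in> {1, -1}"
  show "pcompose (riley_poly (2 * n + 1) (palindrome_signs n e)) [:0, 0, -1:]
      = (-1) ^ n * s_poly (palindrome_signs n e) (2 * n + 1)"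
    using pcompose_riley_poly[OF kmot_signs_palindrome_signs[OF n e]] by simp
  show "(-1) ^ n * s_poly (palindrome_signs n e) (2 * n + 1)
      = v_poly e n * pcompose (v_poly e n) [:0, -1:]"
    by (rule s_poly_palindrome_signs)
  show "v_poly e n * pcompose (v_poly e n) [:0, -1:] = pcompose (f_poly e n) [:0, 0, -1:]"
    using e by (rule v_poly_mult_pcompose_eq_f_poly)
next
  fix \<alpha> n :: nat and \<beta> :: int and \<epsilon> :: "nat \<Rightarrow> int"
  assume "3 \<le> \<alpha>" "odd \<alpha>" "odd \<beta>" "coprime (int \<alpha>) \<beta>"
    and n: "n = (\<alpha> - 1) div 2" and \<epsilon>: "\<epsilon> = two_bridge_signs \<alpha> \<beta>"
  then have kmot: "kmot_signs \<alpha> \<epsilon>"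
    using kmot_signs_two_bridge_signs by simp
  show "pcompose (riley_poly_two_bridge \<alpha> \<beta>) [:0, 0, -1:]
      = (-1) ^ ((\<alpha> - 1) div 2) * s_poly \<epsilon> \<alpha>"
    using pcompose_riley_poly[OF kmot] by (simp add: riley_poly_two_bridge_def \<epsilon>)
  have "\<alpha> = 2 * n + 1"
    using n \<open>odd \<alpha>\<close> by simp
  then show "(-1) ^ ((\<alpha> - 1) div 2) * s_poly \<epsilon> \<alpha>
      = v_poly (rev_signs n \<epsilon>) n * pcompose (v_poly (rev_signs n \<epsilon>) n) [:0, -1:]"
    using s_poly_kmot_signs[of n \<epsilon>] kmot by simp
qed

end
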